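(* Let $V:\mathbb{R}^n\to\mathbb{R}$ be a smooth function whose Hessian $\nabla^2 V$ is bounded on $\mathbb{R}^n$, and let $L=\Delta_v-v\cdot\nabla_v+\nabla V\cdot\nabla_v-v\cdot\nabla_x$ on $\mathbb{R}^{2n}$, with associated forms $\Gamma,\Gamma_2,\Gamma^Z,\Gamma_2^Z$. For every $0<\eta<\frac12$ there exists a constant $K(\eta)\ge-\frac12$ such that for every $f\in C^\infty(\mathbb{R}^{2n})$, \[ \Gamma_2(f)+\Gamma_2^Z(f)\ge -K(\eta)\,\Gamma(f)+\eta\,\Gamma^Z(f) \] pointwise on $\mathbb{R}^{2n}$.
   Context: Points of $\mathbb{R}^{2n}$ are written $(x,v)$ with $x,v\in\mathbb{R}^n$; $\nabla_x,\nabla_v$ are the gradients in $x$ and $v$, $\Delta_v$ is the Laplacian in $v$, and $V=V(x)$, $\nabla V=\nabla V(x)$. For smooth $f,g$ on $\mathbb{R}^{2n}$, \[ \Gamma(f,g)=\tfrac12\big(L(fg)-fLg-gLf\big)=\nabla_v f\cdot\nabla_v g,\qquad \Gamma_2(f,g)=\tfrac12\big(L\Gamma(f,g)-\Gamma(f,Lg)-\Gamma(g,Lf)\big). \] Let $Z_i=2\frac{\partial}{\partial x_i}+\frac{\partial}{\partial v_i}$ for $i=1,\dots,n$, $Zf=2\nabla_x f+\nabla_v f$, and \[ \Gamma^Z(f,g)=Zf\cdot Zg=\sum_{i=1}^n Z_if\,Z_ig,\qquad \Gamma_2^Z(f,g)=\tfrac12\big(L\Gamma^Z(f,g)-\Gamma^Z(f,Lg)-\Gamma^Z(g,Lf)\big).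 \] One writes $\Gamma(f)=\Gamma(f,f)$, $\Gamma_2(f)=\Gamma_2(f,f)$, and similarly $\Gamma^Z(f)=\Gamma^Z(f,f)$, $\Gamma_2^Z(f)=\Gamma_2^Z(f,f)$. *)

theory Defs
  imports "HOL-Analysis.Analysis"
begin

(* Directional derivative. The frechet_derivative is an arbitrary choice where f is not
   differentiable, so this is only meaningful for differentiable f. *)
definition dir_deriv :: "'a::real_normed_vector \<Rightarrow> ('a \<Rightarrow> real) \<Rightarrow> 'a \<Rightarrow> real" where
  "dir_deriv u f p = frechet_derivative f (at p) u"

primrec C_k :: "nat \<Rightarrow> ('a::euclidean_space \<Rightarrow> real) \<Rightarrow> bool" where
  "C_k 0 f \<longleftrightarrow> continuous_on UNIV f"
| "C_k (Suc k) f \<longleftrightarrow> (\<forall>p. f differentiable (at p)) \<and> (\<forall>u. C_k k (dir_deriv u f))"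

definition smooth :: "('a::euclidean_space \<Rightarrow> real) \<Rightarrow> bool" where
  "smooth f \<longleftrightarrow> (\<forall>k. C_k k f)"

definition gradient :: "(real^'n::finite \<Rightarrow> real) \<Rightarrow> real^'n \<Rightarrow> real^'n" where
  "gradient V x = (\<chi> i. dir_deriv (axis i 1) V x)"

definition hessian :: "(real^'n::finite \<Rightarrow> real) \<Rightarrow> real^'n \<Rightarrow> real^'n^'n" where
  "hessian V x = (\<chi> i j. dir_deriv (axis i 1) (dir_deriv (axis j 1) V) x)"

(* R^(2n) is (real^'n) * (real^'n), with points (x, v). *)
type_synonym 'n phase_fun = "(real^'n) \<times> (real^'n) \<Rightarrow> real"

definition partial_x :: "'n::finite \<Rightarrow> 'n phase_fun \<Rightarrow> 'n phase_fun" where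
  "partial_x i f = dir_deriv (axis i 1, 0) f"

definition partial_v :: "'n::finite \<Rightarrow> 'n phase_fun \<Rightarrow> 'n phase_fun" where
  "partial_v i f = dir_deriv (0, axis i 1) f"

definition grad_x :: "'n::finite phase_fun \<Rightarrow> (real^'n) \<times> (real^'n) \<Rightarrow> real^'n" where
  "grad_x f p = (\<chi> i. partial_x i f p)"

definition grad_v :: "'n::finite phase_fun \<Rightarrow> (real^'n) \<times> (real^'n) \<Rightarrow> real^'n" where
  "grad_v f p = (\<chi> i. partial_v i f p)"

definition laplacian_v :: "'n::finite phase_fun \<Rightarrow> 'n phase_fun" where
  "laplacian_v f p = (\<Sum>i\<in>UNIV. partial_v i (partial_v i f) p)"

definition L_op :: "(real^'n::finite \<Rightarrow> real) \<Rightarrow> 'n phase_fun \<Rightarrow> 'n phase_fun" where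
  "L_op V f = (\<lambda>(x, v). laplacian_v f (x, v) - v \<bullet> grad_v f (x, v)
      + gradient V x \<bullet> grad_v f (x, v) - v \<bullet> grad_x f (x, v))"

(* On smooth functions Gamma_form V f g is grad_v f . grad_v g; it is defined from L. *)
definition Gamma_form :: "(real^'n::finite \<Rightarrow> real) \<Rightarrow> 'n phase_fun \<Rightarrow> 'n phase_fun \<Rightarrow> 'n phase_fun" where
  "Gamma_form V f g p =
     (L_op V (\<lambda>q. f q * g q) p - f p * L_op V g p - g p * L_op V f p) / 2"

definition Gamma2_form :: "(real^'n::finite \<Rightarrow> real) \<Rightarrow> 'n phase_fun \<Rightarrow> 'n phase_fun \<Rightarrow> 'n phase_fun" where
  "Gamma2_form V f g p =
     (L_op V (Gamma_form V f g) p - Gamma_form V f (L_op V g) p - Gamma_form V g (L_op V f) p) / 2"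

definition Z_i :: "'n::finite \<Rightarrow> 'n phase_fun \<Rightarrow> 'n phase_fun" where
  "Z_i i f p = 2 * partial_x i f p + partial_v i f p"

definition GammaZ_form :: "'n::finite phase_fun \<Rightarrow> 'n phase_fun \<Rightarrow> 'n phase_fun" where
  "GammaZ_form f g p = (\<Sum>i\<in>UNIV. Z_i i f p * Z_i i g p)"

definition Gamma2Z_form :: "(real^'n::finite \<Rightarrow> real) \<Rightarrow> 'n phase_fun \<Rightarrow> 'n phase_fun \<Rightarrow> 'n phase_fun" where
  "Gamma2Z_form V f g p =
     (L_op V (GammaZ_form f g) p - GammaZ_form f (L_op V g) p - GammaZ_form g (L_op V f) p) / 2"

end

theory Submission
  imports Defs
begin

text \<open>For a constant-coefficient field \<open>D\<close>, the iterated form of \<open>(D f)\<^sup>2\<close> is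
  \<open>|\<nabla>\<^sub>v D f|\<^sup>2 + D f \<cdot> [L, D] f\<close>, and only the commutator has to be controlled. With
  \<open>W = \<nabla>\<^sub>v f\<close>, \<open>X = \<nabla>\<^sub>x f\<close>, \<open>Z = 2 X + W\<close> one has \<open>[L, \<nabla>\<^sub>v] f = W + X\<close> and
  \<open>[L, \<nabla>\<^sub>x] f = - \<nabla>\<^sup>2V W\<close>. Since \<open>W + X = (Z + W) / 2\<close>, the sum of the two iterated forms is at
  least \<open>|Z|\<^sup>2 / 2 + |W|\<^sup>2 / 2 + Z \<cdot> W - 2 Z \<cdot> \<nabla>\<^sup>2V W\<close>, and completing the square absorbs the mixed
  terms at the price of the part \<open>1/2 - \<eta>\<close> of \<open>|Z|\<^sup>2\<close>.\<close>

section \<open>Calculus of directional derivatives\<close>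

text \<open>Uniqueness of the Frechet derivative removes the arbitrary choice in
  \<open>dir_deriv\<close>; the differentiation rules below are read off from this.\<close>

lemma dir_deriv_eqI: "(f has_derivative f') (at p) \<Longrightarrow> dir_deriv u f p = f' u"
  unfolding dir_deriv_def using frechet_derivative_at by metis

lemma has_derivative_dir_deriv:
  "f differentiable (at p) \<Longrightarrow> (f has_derivative (\<lambda>u. dir_deriv u f p)) (at p)"
  unfolding dir_deriv_def by (simp add: frechet_derivative_works)

lemma dir_deriv_const [simp]: "dir_deriv u (\<lambda>q. c) = (\<lambda>q. 0)"
  by (simp add: dir_deriv_def fun_eq_iff)

lemma dir_deriv_add:
  assumes "f differentiable (at p)" "g differentiable (at p)"
  shows "dir_deriv u (\<lambda>q. f q + g q) p = dir_deriv u f p + dir_deriv u g p"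
  using dir_deriv_eqI[OF has_derivative_add[OF assms[THEN has_derivative_dir_deriv]]] .

lemma dir_deriv_diff:
  assumes "f differentiable (at p)" "g differentiable (at p)"
  shows "dir_deriv u (\<lambda>q. f q - g q) p = dir_deriv u f p - dir_deriv u g p"
  using dir_deriv_eqI[OF has_derivative_diff[OF assms[THEN has_derivative_dir_deriv]]] .

lemma dir_deriv_mult:
  assumes "f differentiable (at p)" "g differentiable (at p)"
  shows "dir_deriv u (\<lambda>q. f q * g q) p = f p * dir_deriv u g p + dir_deriv u f p * g p"
  using dir_deriv_eqI[OF has_derivative_mult[OF assms[THEN has_derivative_dir_deriv]]] .

lemma dir_deriv_sum:
  assumes "\<And>i. i \<in> I \<Longrightarrow> f i differentiable (at p)"
  shows "dir_deriv u (\<lambda>q. \<Sum>i\<in>I. f i q) p = (\<Sum>i\<in>I. dir_deriv u (f i) p)"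
  by (rule dir_deriv_eqI) (intro has_derivative_sum has_derivative_dir_deriv assms)

lemma dir_deriv_bounded_linear:
  "bounded_linear l \<Longrightarrow> dir_deriv u l p = l u"
  by (rule dir_deriv_eqI) (rule bounded_linear_imp_has_derivative)

lemma dir_deriv_fst:
  assumes "g differentiable (at (fst p))"
  shows "dir_deriv u (\<lambda>q. g (fst q)) p = dir_deriv (fst u) g (fst p)"
  by (rule dir_deriv_eqI)
     (rule has_derivative_compose[OF has_derivative_fst[OF has_derivative_ident]
        has_derivative_dir_deriv[OF assms]])

text \<open>The Frechet derivative is linear. Instances with zero coefficients or zero vectors later
  give homogeneity and the vanishing along the zero direction.\<close>

lemma dir_deriv_combine:
  assumes "f differentiable (at p)"
  shows "dir_deriv (a *\<^sub>R u + b *\<^sub>R w) f p = a * dir_deriv u f p + b * dir_deriv w f p"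
proof -
  interpret linear "\<lambda>u. dir_deriv u f p"
    using has_derivative_linear[OF has_derivative_dir_deriv[OF assms]] .
  show ?thesis by (simp add: add scale)
qed

section \<open>Smooth functions\<close>

lemma C_k_SucD: "C_k (Suc k) f \<Longrightarrow> C_k k f"
proof (induction k arbitrary: f)
  case 0
  then show ?case
    by (simp add: continuous_on_eq_continuous_at differentiable_imp_continuous_within)
next
  case (Suc k)
  then show ?case by (simp del: C_k.simps(2) add: C_k.simps(2)[of "Suc k"] C_k.simps(2)[of k])
qed

lemma smooth_C_k: "smooth f \<Longrightarrow> C_k k f"
  by (simp add: smooth_def)

lemma smooth_differentiable: "smooth f \<Longrightarrow> f differentiable (at p)"
  using smooth_C_k[of f "Suc 0"] by simp

lemma smooth_dir_deriv: "smooth f \<Longrightarrow> smooth (dir_deriv u f)"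
  unfolding smooth_def by (metis C_k.simps(2))

lemma C_k_const: "C_k k (\<lambda>q. c)"
  by (induction k arbitrary: c) simp_all

lemma C_k_add: "C_k k f \<Longrightarrow> C_k k g \<Longrightarrow> C_k k (\<lambda>q. f q + g q)"
proof (induction k arbitrary: f g)
  case 0
  then show ?case by (simp add: continuous_on_add)
next
  case (Suc k)
  then have "dir_deriv u (\<lambda>q. f q + g q) = (\<lambda>q. dir_deriv u f q + dir_deriv u g q)" for u
    by (simp add: fun_eq_iff dir_deriv_add)
  with Suc show ?case by simp
qed

lemma C_k_diff: "C_k k f \<Longrightarrow> C_k k g \<Longrightarrow> C_k k (\<lambda>q. f q - g q)"
proof (induction k arbitrary: f g)
  case 0
  then show ?case by (simp add: continuous_on_diff)
next
  case (Suc k)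
  then have "dir_deriv u (\<lambda>q. f q - g q) = (\<lambda>q. dir_deriv u f q - dir_deriv u g q)" for u
    by (simp add: fun_eq_iff dir_deriv_diff)
  with Suc show ?case by simp
qed

lemma C_k_mult: "C_k k f \<Longrightarrow> C_k k g \<Longrightarrow> C_k k (\<lambda>q. f q * g q)"
proof (induction k arbitrary: f g)
  case 0
  then show ?case by (simp add: continuous_on_mult)
next
  case (Suc k)
  then have "dir_deriv u (\<lambda>q. f q * g q) = (\<lambda>q. f q * dir_deriv u g q + dir_deriv u f q * g q)" for u
    by (simp add: fun_eq_iff dir_deriv_mult)
  \<comment> \<open>The product rule keeps one factor undifferentiated, so \<open>f\<close> and
    \<open>g\<close> are also needed at level \<open>k\<close>.\<close>
  with Suc C_k_SucD[OF Suc.prems(1)] C_k_SucD[OF Suc.prems(2)] show ?case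
    by (simp add: C_k_add)
qed

lemma C_k_fst:
  fixes g :: "'a::euclidean_space \<Rightarrow> real"
  shows "C_k k g \<Longrightarrow> C_k k (\<lambda>q::'a \<times> 'b::euclidean_space. g (fst q))"
proof (induction k arbitrary: g)
  case 0
  then show ?case
    by (auto intro!: continuous_on_compose2[of UNIV g] continuous_intros)
next
  case (Suc k)
  then have "dir_deriv u (\<lambda>q::'a \<times> 'b. g (fst q)) = (\<lambda>q. dir_deriv (fst u) g (fst q))" for u
    by (simp add: fun_eq_iff dir_deriv_fst)
  moreover have "(\<lambda>q::'a \<times> 'b. g (fst q)) differentiable (at p)" for p
    using Suc.prems has_derivative_compose[OF has_derivative_fst[OF has_derivative_ident]
        has_derivative_dir_deriv] unfolding differentiable_def
    by (metis C_k.simps(2) differentiable_def)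
  ultimately show ?case using Suc by simp
qed

text \<open>Each directional derivative is the constant \<open>l u\<close>, so a case split on
  \<open>k\<close> replaces an induction.\<close>

lemma C_k_bounded_linear:
  assumes "bounded_linear l"
  shows "C_k k l"
proof (cases k)
  case 0
  then show ?thesis by (simp add: assms linear_continuous_on)
next
  case (Suc m)
  have "dir_deriv u l = (\<lambda>q. l u)" for u
    by (simp add: fun_eq_iff dir_deriv_bounded_linear assms)
  then show ?thesis
    using Suc by (simp add: C_k_const bounded_linear_imp_differentiable assms)
qed

lemma smooth_add: "smooth f \<Longrightarrow> smooth g \<Longrightarrow> smooth (\<lambda>q. f q + g q)"
  by (simp add: smooth_def C_k_add)

lemma smooth_diff: "smooth f \<Longrightarrow> smooth g \<Longrightarrow> smooth (\<lambda>q. f q - g q)"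
  by (simp add: smooth_def C_k_diff)

lemma smooth_mult: "smooth f \<Longrightarrow> smooth g \<Longrightarrow> smooth (\<lambda>q. f q * g q)"
  by (simp add: smooth_def C_k_mult)

lemma smooth_fst: "smooth g \<Longrightarrow> smooth (\<lambda>q. g (fst q))"
  by (simp add: smooth_def C_k_fst)

lemma smooth_snd_nth: "smooth (\<lambda>q::'a::euclidean_space \<times> (real^'n). snd q $ i)"
  unfolding smooth_def
  by (intro allI C_k_bounded_linear bounded_linear_compose[OF bounded_linear_vec_nth bounded_linear_snd])

lemma smooth_sum: "(\<And>i. i \<in> I \<Longrightarrow> smooth (f i)) \<Longrightarrow> smooth (\<lambda>q. \<Sum>i\<in>I. f i q)"
proof (induction I rule: infinite_finite_induct)
  case (insert x I)
  then show ?case by (simp add: smooth_add)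
qed (simp_all add: smooth_def C_k_const)

lemmas smooth_rules = smooth_add smooth_diff smooth_mult smooth_fst smooth_snd_nth smooth_sum
  smooth_dir_deriv

section \<open>Symmetry of second directional derivatives\<close>

lemma has_real_derivative_along_line:
  fixes f :: "'a::real_normed_vector \<Rightarrow> real"
  assumes "f differentiable (at (p + s *\<^sub>R u))"
  shows "((\<lambda>s. f (p + s *\<^sub>R u)) has_real_derivative dir_deriv u f (p + s *\<^sub>R u)) (at s)"
proof -
  have "((\<lambda>s. p + s *\<^sub>R u) has_derivative (\<lambda>h. h *\<^sub>R u)) (at s)"
    by (auto intro!: derivative_eq_intros)
  from has_derivative_compose[OF this has_derivative_dir_deriv[OF assms]]
  have "((\<lambda>s. f (p + s *\<^sub>R u)) has_derivative (\<lambda>h. dir_deriv (h *\<^sub>R u) f (p + s *\<^sub>R u))) (at s)" .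
  moreover have "dir_deriv (h *\<^sub>R u) f (p + s *\<^sub>R u) = dir_deriv u f (p + s *\<^sub>R u) * h" for h
    using dir_deriv_combine[OF assms, of h u 0 0] by simp
  ultimately show ?thesis by (simp add: has_field_derivative_def)
qed

text \<open>Two uses of the mean value theorem: first along \<open>u\<close>, for the increment of
  \<open>f\<close> under the shift by \<open>h *\<^sub>R w\<close>; then along \<open>w\<close>, for
  \<open>dir_deriv u f\<close>.\<close>

lemma second_difference_eq:
  fixes f :: "'a::real_normed_vector \<Rightarrow> real"
  assumes f: "\<And>q. f differentiable (at q)" and fu: "\<And>q. dir_deriv u f differentiable (at q)"
    and h: "0 < h"
  obtains s t where "0 < s" "s < h" "0 < t" "t < h"
    "f (p + h *\<^sub>R u + h *\<^sub>R w) - f (p + h *\<^sub>R u) - f (p + h *\<^sub>R w) + f p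
      = h\<^sup>2 * dir_deriv w (dir_deriv u f) (p + s *\<^sub>R u + t *\<^sub>R w)"
proof -
  have "((\<lambda>s. f (p + h *\<^sub>R w + s *\<^sub>R u) - f (p + s *\<^sub>R u)) has_real_derivative
      dir_deriv u f (p + h *\<^sub>R w + s *\<^sub>R u) - dir_deriv u f (p + s *\<^sub>R u)) (at s)" for s
    by (intro DERIV_diff has_real_derivative_along_line f)
  from MVT2[OF h this] obtain s where s: "0 < s" "s < h" and
    eq1: "f (p + h *\<^sub>R w + h *\<^sub>R u) - f (p + h *\<^sub>R u) - (f (p + h *\<^sub>R w) - f p)
      = h * (dir_deriv u f (p + h *\<^sub>R w + s *\<^sub>R u) - dir_deriv u f (p + s *\<^sub>R u))"
    by auto
  have "((\<lambda>t. dir_deriv u f (p + s *\<^sub>R u + t *\<^sub>R w)) has_real_derivative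
      dir_deriv w (dir_deriv u f) (p + s *\<^sub>R u + t *\<^sub>R w)) (at t)" for t
    by (intro has_real_derivative_along_line fu)
  from MVT2[OF h this] obtain t where t: "0 < t" "t < h" and
    eq2: "dir_deriv u f (p + s *\<^sub>R u + h *\<^sub>R w) - dir_deriv u f (p + s *\<^sub>R u)
      = h * dir_deriv w (dir_deriv u f) (p + s *\<^sub>R u + t *\<^sub>R w)"
    by auto
  show thesis
    using that[OF s t] eq1 eq2 by (simp add: algebra_simps power2_eq_square)
qed

lemma second_difference_tendsto:
  fixes f :: "'a::real_normed_vector \<Rightarrow> real"
  assumes f: "\<And>q. f differentiable (at q)" "\<And>q. dir_deriv u f differentiable (at q)"
    and cont: "continuous (at p) (dir_deriv w (dir_deriv u f))"
  shows "((\<lambda>h. (f (p + h *\<^sub>R u + h *\<^sub>R w) - f (p + h *\<^sub>R u) - f (p + h *\<^sub>R w) + f p) / h\<^sup>2)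
    \<longlongrightarrow> dir_deriv w (dir_deriv u f) p) (at_right 0)"
proof (rule tendstoI)
  fix e :: real assume "0 < e"
  with cont obtain d where d: "0 < d"
    "\<And>q. dist q p < d \<Longrightarrow> dist (dir_deriv w (dir_deriv u f) q) (dir_deriv w (dir_deriv u f) p) < e"
    unfolding continuous_at_eps_delta by metis
  \<comment> \<open>For \<open>h < r\<close> the intermediate point lies within \<open>d\<close> of
    \<open>p\<close>; the summand 1 keeps the denominator positive when \<open>u\<close> and
    \<open>w\<close> vanish.\<close>
  define r where "r = d / (norm u + norm w + 1)"
  have N: "0 < norm u + norm w + 1" by (smt (verit) norm_ge_zero)
  then have "0 < r" using d by (simp add: r_def)
  have "dist ((f (p + h *\<^sub>R u + h *\<^sub>R w) - f (p + h *\<^sub>R u) - f (p + h *\<^sub>R w) + f p) / h\<^sup>2)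
      (dir_deriv w (dir_deriv u f) p) < e" if h: "0 < h" "h < r" for h
  proof -
    obtain s t where st: "0 < s" "s < h" "0 < t" "t < h" and
      eq: "f (p + h *\<^sub>R u + h *\<^sub>R w) - f (p + h *\<^sub>R u) - f (p + h *\<^sub>R w) + f p
      = h\<^sup>2 * dir_deriv w (dir_deriv u f) (p + s *\<^sub>R u + t *\<^sub>R w)"
      using second_difference_eq[OF f h(1)] by blast
    have "dist (p + s *\<^sub>R u + t *\<^sub>R w) p = norm (s *\<^sub>R u + t *\<^sub>R w)"
      by (simp add: dist_norm add.assoc)
    also have "\<dots> \<le> s * norm u + t * norm w"
      using norm_triangle_ineq[of "s *\<^sub>R u" "t *\<^sub>R w"] st by simp
    also have "\<dots> \<le> h * norm u + h * norm w"
      using st by (intro add_mono mult_right_mono) auto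
    also have "\<dots> < h * (norm u + norm w + 1)"
      using h by (simp add: algebra_simps)
    also have "\<dots> < d"
      using h N by (simp add: r_def pos_less_divide_eq)
    finally show ?thesis using d(2) h by (simp add: eq)
  qed
  then show "\<forall>\<^sub>F h in at_right 0. dist ((f (p + h *\<^sub>R u + h *\<^sub>R w) - f (p + h *\<^sub>R u)
      - f (p + h *\<^sub>R w) + f p) / h\<^sup>2) (dir_deriv w (dir_deriv u f) p) < e"
    using \<open>0 < r\<close> by (auto simp: eventually_at_right_field intro!: exI[of _ r])
qed

text \<open>The second difference is symmetric in \<open>u\<close> and \<open>w\<close>, and its
  quotient by \<open>h\<^sup>2\<close> tends to either mixed derivative, so the two limits
  coincide.\<close>

lemma dir_deriv_commute:
  assumes "smooth f"
  shows "dir_deriv u (dir_deriv w f) = dir_deriv w (dir_deriv u f)"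
proof
  fix p
  have diff: "f differentiable (at q)" "dir_deriv x f differentiable (at q)" for q x
    using assms smooth_differentiable smooth_dir_deriv by blast+
  have cont: "continuous (at p) (dir_deriv x (dir_deriv y f))" for x y
    using assms smooth_differentiable smooth_dir_deriv differentiable_imp_continuous_within by blast
  have "((\<lambda>h. (f (p + h *\<^sub>R u + h *\<^sub>R w) - f (p + h *\<^sub>R u) - f (p + h *\<^sub>R w) + f p) / h\<^sup>2)
      \<longlongrightarrow> dir_deriv u (dir_deriv w f) p) (at_right 0)"
    using second_difference_tendsto[OF diff cont, of w u] by (simp add: algebra_simps)
  with second_difference_tendsto[OF diff cont, of u w]
  show "dir_deriv u (dir_deriv w f) p = dir_deriv w (dir_deriv u f) p"
    using tendsto_unique trivial_limit_at_right_real by blast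
qed

section \<open>The operator and its commutators\<close>

text \<open>Written as one sum of products of smooth functions of \<open>q\<close>, the operator can
  be differentiated by the rules above.\<close>

lemma L_op_eq:
  "L_op V f = (\<lambda>q. \<Sum>j\<in>UNIV. dir_deriv (0, axis j 1) (dir_deriv (0, axis j 1) f) q
     + (dir_deriv (axis j 1) V (fst q) - snd q $ j) * dir_deriv (0, axis j 1) f q
     - snd q $ j * dir_deriv (axis j 1, 0) f q)"
  by (auto simp: fun_eq_iff L_op_def laplacian_v_def grad_v_def grad_x_def gradient_def
      partial_v_def partial_x_def inner_vec_def sum.distrib sum_subtractf left_diff_distrib)

lemma smooth_L_op: "smooth V \<Longrightarrow> smooth f \<Longrightarrow> smooth (L_op V f)"
  unfolding L_op_eq by (intro smooth_rules)

lemma L_op_sum: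
  assumes "\<And>i. i \<in> I \<Longrightarrow> smooth (F i)"
  shows "L_op V (\<lambda>q. \<Sum>i\<in>I. F i q) p = (\<Sum>i\<in>I. L_op V (F i) p)"
proof -
  \<comment> \<open>An equality of functions, so that it also rewrites under the outer derivative in
    the second-order part.\<close>
  have D: "dir_deriv u (\<lambda>q. \<Sum>i\<in>I. F i q) = (\<lambda>q. \<Sum>i\<in>I. dir_deriv u (F i) q)" for u
    using assms by (simp add: fun_eq_iff dir_deriv_sum smooth_differentiable)
  have DD: "dir_deriv u (\<lambda>q. \<Sum>i\<in>I. dir_deriv u (F i) q) p = (\<Sum>i\<in>I. dir_deriv u (dir_deriv u (F i)) p)" for u
    using assms by (simp add: dir_deriv_sum smooth_differentiable smooth_dir_deriv)
  show ?thesis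
    unfolding L_op_eq D DD
    by (subst sum.swap) (simp add: sum_distrib_left sum.distrib sum_subtractf)
qed

text \<open>The first-order part of the operator is a derivation; only the second derivatives in
  \<open>v\<close> leave a cross term.\<close>

lemma L_op_mult:
  assumes "smooth f" "smooth g"
  shows "L_op V (\<lambda>q. f q * g q) p = f p * L_op V g p + g p * L_op V f p
    + 2 * (\<Sum>j\<in>UNIV. dir_deriv (0, axis j 1) f p * dir_deriv (0, axis j 1) g p)"
proof -
  have D: "dir_deriv u (\<lambda>q. f q * g q) = (\<lambda>q. f q * dir_deriv u g q + dir_deriv u f q * g q)" for u
    using assms by (simp add: fun_eq_iff dir_deriv_mult smooth_differentiable)
  have DD: "dir_deriv u (\<lambda>q. f q * dir_deriv u g q + dir_deriv u f q * g q) p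
    = f p * dir_deriv u (dir_deriv u g) p + g p * dir_deriv u (dir_deriv u f) p
      + 2 * (dir_deriv u f p * dir_deriv u g p)" for u
    using assms
    by (simp add: dir_deriv_mult dir_deriv_add smooth_differentiable smooth_rules)
  show ?thesis
    unfolding L_op_eq D DD sum_distrib_left sum.distrib[symmetric]
    by (rule sum.cong) (simp_all add: algebra_simps)
qed

text \<open>An equality of functions because \<open>Gamma2_form\<close> applies \<open>L_op\<close>
  to the whole form.\<close>

lemma Gamma_form_eq:
  assumes "smooth f" "smooth g"
  shows "Gamma_form V f g = (\<lambda>p. \<Sum>j\<in>UNIV. dir_deriv (0, axis j 1) f p * dir_deriv (0, axis j 1) g p)"
  using assms by (simp add: fun_eq_iff Gamma_form_def L_op_mult)

text \<open>As a derivative along one constant vector, \<open>Z_i\<close> falls under the same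
  commutator formula as the derivatives in \<open>v\<close>.\<close>

lemma Z_i_eq:
  assumes "smooth f"
  shows "Z_i i f = dir_deriv (2 *\<^sub>R axis i 1, axis i 1) f"
  using dir_deriv_combine[OF smooth_differentiable[OF assms], of 2 "(axis i 1, 0)" 1 "(0, axis i 1)"]
  by (simp add: fun_eq_iff Z_i_def partial_x_def partial_v_def)

text \<open>Constant-coefficient derivatives commute, so only the derivatives of the coefficients
  survive: \<open>v\<close> contributes \<open>b\<close>, and the gradient of \<open>V\<close>
  contributes its derivative along \<open>a\<close>.\<close>

lemma L_op_commutator:
  fixes a b :: "real^'n::finite"
  assumes V: "smooth V" and f: "smooth f"
  shows "L_op V (dir_deriv (a, b) f) p - dir_deriv (a, b) (L_op V f) p =
    (\<Sum>j\<in>UNIV. b $ j * (dir_deriv (0, axis j 1) f p + dir_deriv (axis j 1, 0) f p)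
      - dir_deriv a (dir_deriv (axis j 1) V) (fst p) * dir_deriv (0, axis j 1) f p)"
proof -
  have [simp]: "dir_deriv (a, b) (\<lambda>q::(real^'n) \<times> (real^'n). snd q $ j) p = b $ j" for j
    by (subst dir_deriv_bounded_linear)
       (simp_all add: bounded_linear_compose[OF bounded_linear_vec_nth bounded_linear_snd])
  have [simp]: "dir_deriv (a, b) (\<lambda>q::(real^'n) \<times> (real^'n). dir_deriv (axis j 1) V (fst q)) p
      = dir_deriv a (dir_deriv (axis j 1) V) (fst p)" for j
    by (subst dir_deriv_fst) (simp_all add: V smooth_differentiable smooth_rules)
  have "dir_deriv (a, b) (L_op V f) p =
    (\<Sum>j\<in>UNIV. dir_deriv (a, b) (dir_deriv (0, axis j 1) (dir_deriv (0, axis j 1) f)) p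
     + ((dir_deriv (axis j 1) V (fst p) - snd p $ j) * dir_deriv (a, b) (dir_deriv (0, axis j 1) f) p
       + (dir_deriv a (dir_deriv (axis j 1) V) (fst p) - b $ j) * dir_deriv (0, axis j 1) f p)
     - (snd p $ j * dir_deriv (a, b) (dir_deriv (axis j 1, 0) f) p
       + b $ j * dir_deriv (axis j 1, 0) f p))"
    unfolding L_op_eq
    using V f by (simp add: dir_deriv_sum dir_deriv_add dir_deriv_diff dir_deriv_mult
        smooth_differentiable smooth_rules)
  \<comment> \<open>Moving \<open>(a, b)\<close> outermost makes the terms with undifferentiated
    coefficients identical on both sides, and they cancel.\<close>
  moreover have "dir_deriv w (dir_deriv (a, b) f) = dir_deriv (a, b) (dir_deriv w f)"
    "dir_deriv w (dir_deriv (a, b) (dir_deriv w f)) = dir_deriv (a, b) (dir_deriv w (dir_deriv w f))" for w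
    using f by (simp_all add: dir_deriv_commute[of _ "(a, b)"] smooth_rules)
  ultimately show ?thesis
    unfolding L_op_eq sum_subtractf[symmetric]
    by (simp add: sum_subtractf[symmetric] algebra_simps)
qed

section \<open>Lower bounds for the iterated forms\<close>

lemma iterated_form_ge:
  fixes u :: "'i \<Rightarrow> (real^'n::finite) \<times> (real^'n)"
  assumes f: "smooth f"
  shows "(L_op V (\<lambda>q. \<Sum>i\<in>I. dir_deriv (u i) f q * dir_deriv (u i) f q) p
      - 2 * (\<Sum>i\<in>I. dir_deriv (u i) f p * dir_deriv (u i) (L_op V f) p)) / 2
    \<ge> (\<Sum>i\<in>I. dir_deriv (u i) f p * (L_op V (dir_deriv (u i) f) p - dir_deriv (u i) (L_op V f) p))"
proof -
  \<comment> \<open>By \<open>L_op_mult\<close> the gap is twice the squared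
    \<open>v\<close>-gradient of \<open>dir_deriv (u i) f\<close>; discarding it is the only loss
    here.\<close>
  have "L_op V (\<lambda>q. dir_deriv (u i) f q * dir_deriv (u i) f q) p
     \<ge> 2 * (dir_deriv (u i) f p * L_op V (dir_deriv (u i) f) p)" for i
    using f by (simp add: L_op_mult smooth_rules sum_nonneg)
  then have "(\<Sum>i\<in>I. 2 * (dir_deriv (u i) f p * L_op V (dir_deriv (u i) f) p))
    \<le> L_op V (\<lambda>q. \<Sum>i\<in>I. dir_deriv (u i) f q * dir_deriv (u i) f q) p"
    using f by (subst L_op_sum) (auto intro!: sum_mono smooth_rules)
  then show ?thesis
    by (simp add: right_diff_distrib sum_subtractf sum_distrib_left[symmetric])
qed

text \<open>The directions \<open>(0, axis i 1)\<close> have no \<open>x\<close>-component, which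
  removes the Hessian from the commutator; \<open>axis i 1\<close> then selects the summand
  \<open>j = i\<close>.\<close>

lemma Gamma2_form_ge:
  assumes V: "smooth V" and f: "smooth f"
  shows "Gamma2_form V f f p \<ge> grad_v f p \<bullet> (grad_v f p + grad_x f p)"
proof -
  have 0: "dir_deriv 0 (dir_deriv w V) y = 0" for w y
    using dir_deriv_combine[of "dir_deriv w V" y 0 0 0 0] V
    by (simp add: smooth_differentiable smooth_rules)
  have "L_op V (dir_deriv (0, axis i 1) f) p - dir_deriv (0, axis i 1) (L_op V f) p
      = partial_v i f p + partial_x i f p" for i
    by (simp add: L_op_commutator[OF V f] 0 axis_def if_distrib[of "\<lambda>x. x * _"]
        partial_v_def partial_x_def cong: if_cong)
  with iterated_form_ge[OF f, where V = V and I = UNIV and u = "\<lambda>i. (0, axis i 1)" and p = p] show ?thesis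
    by (simp add: Gamma2_form_def Gamma_form_eq f smooth_L_op[OF V f] inner_vec_def
        grad_v_def grad_x_def partial_v_def partial_x_def)
qed

text \<open>The \<open>x\<close>-component \<open>2 *\<^sub>R axis i 1\<close> brings in twice the
  Hessian. The index order in \<open>hessian\<close> makes the sum over \<open>j\<close> the entry
  \<open>i\<close> of the matrix-vector product.\<close>

lemma Gamma2Z_form_ge:
  assumes V: "smooth V" and f: "smooth f"
  shows "Gamma2Z_form V f f p \<ge>
    (\<chi> i. Z_i i f p) \<bullet> (grad_v f p + grad_x f p - 2 *\<^sub>R (hessian V (fst p) *v grad_v f p))"
proof -
  have 2: "dir_deriv (2 *\<^sub>R w) (dir_deriv w' V) y = 2 * dir_deriv w (dir_deriv w' V) y" for w w' y
    using dir_deriv_combine[of "dir_deriv w' V" y 2 w 0 0] V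
    by (simp add: smooth_differentiable smooth_rules)
  have "L_op V (dir_deriv (2 *\<^sub>R axis i 1, axis i 1) f) p
        - dir_deriv (2 *\<^sub>R axis i 1, axis i 1) (L_op V f) p
      = partial_v i f p + partial_x i f p - 2 * (hessian V (fst p) *v grad_v f p) $ i" for i
    by (simp add: L_op_commutator[OF V f] 2 axis_def[of i] if_distrib[of "\<lambda>x. x * _"]
        sum_subtractf hessian_def matrix_vector_mult_def grad_v_def sum_distrib_left mult.assoc
        partial_v_def partial_x_def cong: if_cong)
  with iterated_form_ge[OF f, where V = V and I = UNIV and u = "\<lambda>i. (2 *\<^sub>R axis i 1, axis i 1)" and p = p] show ?thesis
    by (simp add: Gamma2Z_form_def GammaZ_form_def[abs_def] Z_i_eq f smooth_L_op[OF V f] inner_vec_def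
        grad_v_def[of f] grad_x_def[of f])
qed

section \<open>Uniform operator bound and completion of the square\<close>

lemma bounded_matrices_onorm:
  fixes A :: "'a \<Rightarrow> real^'n::finite^'m::finite"
  assumes "bounded (range A)"
  obtains M where "0 \<le> M" "\<And>x w. norm (A x *v w) \<le> M * norm w"
proof -
  obtain B where B: "0 < B" "\<And>x. norm (A x) \<le> B"
    using assms unfolding bounded_pos by auto
  have comp: "\<bar>A x $ i $ j\<bar> \<le> B" for x i j
    using component_le_norm_cart[of "A x $ i" j] Finite_Cartesian_Product.norm_nth_le[of "A x" i] B(2)[of x]
    by linarith
  show thesis
  proof (rule that)
    \<comment> \<open>All entries of all \<open>A x\<close> are at most \<open>B\<close> in absolute
      value; the operator norm is then at most \<open>B\<close> times the number of entries,
      uniformly in \<open>x\<close>.\<close>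
    show "0 \<le> real CARD('m) * real CARD('n) * B" using B by simp
    show "norm (A x *v w) \<le> (real CARD('m) * real CARD('n) * B) * norm w" for x w
      using onorm_le_matrix_component[of "A x" B, OF comp]
        onorm[OF matrix_vector_mul_bounded_linear, of "A x" w]
      by (meson mult_right_mono norm_ge_zero order_trans)
  qed
qed

text \<open>With \<open>d = 1/2 - \<eta>\<close>, the left side minus the right side is the perfect
  square \<open>d * (z - c * w / (2 * d))\<^sup>2\<close>.\<close>

lemma quadratic_form_bound:
  fixes c \<eta> z w :: real
  assumes "\<eta> < 1/2"
  shows "z\<^sup>2 / 2 + w\<^sup>2 / 2 - c * z * w
    \<ge> - (c\<^sup>2 / (4 * (1/2 - \<eta>)) - 1/2) * w\<^sup>2 + \<eta> * z\<^sup>2"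
proof -
  define d where "d = 1/2 - \<eta>"
  have "d > 0" using assms by (simp add: d_def)
  then have "d * z\<^sup>2 - c * z * w + c\<^sup>2 / (4 * d) * w\<^sup>2 = d * (z - c * w / (2 * d))\<^sup>2"
    by (simp add: power2_eq_square field_simps)
  also have "\<dots> \<ge> 0" using \<open>d > 0\<close> by simp
  finally show ?thesis unfolding d_def[symmetric] by (simp add: d_def algebra_simps)
qed

section \<open>Choice of the constant and the pointwise inequality\<close>

theorem proposition2p4:
  fixes V :: "real^'n::finite \<Rightarrow> real"
  assumes "smooth V"
    and "bounded (range (hessian V))"
  shows "\<forall>\<eta>::real. 0 < \<eta> \<and> \<eta> < 1/2 \<longrightarrow>
    (\<exists>K::real. K \<ge> -1/2 \<and>
      (\<forall>f :: (real^'n) \<times> (real^'n) \<Rightarrow> real. smooth f \<longrightarrow>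
        (\<forall>p. Gamma2_form V f f p + Gamma2Z_form V f f p \<ge> - K * Gamma_form V f f p + \<eta> * GammaZ_form f f p)))"
proof (intro allI impI, elim conjE)
  fix \<eta> :: real assume \<eta>: "0 < \<eta>" "\<eta> < 1/2"
  obtain M where M: "0 \<le> M" "\<And>x w. norm (hessian V x *v w) \<le> M * norm w"
    using bounded_matrices_onorm[OF assms(2)] by blast
  \<comment> \<open>This is \<open>quadratic_form_bound\<close> with \<open>c = 1 + 2 * M\<close>:
    the 1 pays for \<open>Z \<bullet> W\<close>, the \<open>2 * M\<close> for the Hessian term. It
    is fixed before \<open>f\<close> and \<open>p\<close>, and its fraction is nonnegative since
    \<open>\<eta> < 1/2\<close>.\<close>
  define K where "K = (1 + 2 * M)\<^sup>2 / (4 * (1/2 - \<eta>)) - 1/2"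
  show "\<exists>K::real. K \<ge> -1/2 \<and>
      (\<forall>f :: (real^'n) \<times> (real^'n) \<Rightarrow> real. smooth f \<longrightarrow>
        (\<forall>p. Gamma2_form V f f p + Gamma2Z_form V f f p \<ge> - K * Gamma_form V f f p + \<eta> * GammaZ_form f f p))"
  proof (intro exI[of _ K] conjI allI impI)
    show "K \<ge> -1/2" using \<eta> by (simp add: K_def)
  next
    fix f :: "(real^'n) \<times> (real^'n) \<Rightarrow> real" and p
    assume f: "smooth f"
    define W where "W = grad_v f p"
    define Z where "Z = (\<chi> i. Z_i i f p)"
    define H where "H = hessian V (fst p) *v W"
    have WX: "W + grad_x f p = (1/2) *\<^sub>R (Z + W)"
      by (simp add: vec_eq_iff W_def Z_def grad_v_def grad_x_def Z_i_def)
    have \<Gamma>: "Gamma_form V f f p = (norm W)\<^sup>2"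
      unfolding power2_norm_eq_inner
      by (simp add: Gamma_form_eq f W_def grad_v_def partial_v_def inner_vec_def)
    have \<Gamma>Z: "GammaZ_form f f p = (norm Z)\<^sup>2"
      unfolding power2_norm_eq_inner by (simp add: GammaZ_form_def Z_def inner_vec_def)
    \<comment> \<open>The two mixed terms enter with opposite signs, so \<open>Z \<bullet> W\<close>
      is bounded from below and \<open>Z \<bullet> H\<close> from above.\<close>
    have ZW: "Z \<bullet> W \<ge> - (norm Z * norm W)"
      using Cauchy_Schwarz_ineq2[of Z W] by linarith
    have "Z \<bullet> H \<le> norm Z * norm H" by (rule norm_cauchy_schwarz)
    also have "\<dots> \<le> norm Z * (M * norm W)"
      unfolding H_def by (intro mult_left_mono M(2) norm_ge_zero)
    finally have ZH: "Z \<bullet> H \<le> M * (norm Z * norm W)" by (simp add: mult_ac)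
    have "- K * (norm W)\<^sup>2 + \<eta> * (norm Z)\<^sup>2
        \<le> (norm Z)\<^sup>2 / 2 + (norm W)\<^sup>2 / 2 - (1 + 2 * M) * norm Z * norm W"
      unfolding K_def by (rule quadratic_form_bound[OF \<eta>(2)])
    also have "\<dots> \<le> (norm Z)\<^sup>2 / 2 + (norm W)\<^sup>2 / 2 + Z \<bullet> W - 2 * (Z \<bullet> H)"
      using ZW ZH by (simp add: algebra_simps)
    \<comment> \<open>After \<open>WX\<close>, each of the two inner products supplies half of
      \<open>Z \<bullet> W\<close>.\<close>
    also have "\<dots> = W \<bullet> (W + grad_x f p) + Z \<bullet> (W + grad_x f p - 2 *\<^sub>R H)"
      unfolding WX power2_norm_eq_inner
      by (simp add: inner_simps inner_commute[of W Z] field_simps)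
    also have "\<dots> \<le> Gamma2_form V f f p + Gamma2Z_form V f f p"
      unfolding W_def Z_def H_def
      by (intro add_mono Gamma2_form_ge Gamma2Z_form_ge assms(1) f)
    finally show "Gamma2_form V f f p + Gamma2Z_form V f f p
        \<ge> - K * Gamma_form V f f p + \<eta> * GammaZ_form f f p"
      by (simp add: \<Gamma> \<Gamma>Z)
  qed
qed

end
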